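(* Let $l,n$ be positive integers and let $\mathbf{U}^\tau$ be the $ln\times ln$ matrix of the linear transformation $\tau$ acting on flattened $l\times n$ matrices. Then $\mathbf{U}^\tau$ has at most $2\cdot\min(n,l)-1$ non-zero diagonals, no matter whether matrices are flattened in column-major order or in row-major order.
   Context: All indices start at $0$, and $[x]_y$ denotes $x\bmod y\in\{0,\dots,y-1\}$. Matrices have entries in a commutative ring $R$. For an $l\times n$ matrix $\mathcal{B}$, $\tau(\mathcal{B})$ is the $l\times n$ matrix with $\tau(\mathcal{B})_{i,j}=\mathcal{B}_{[i+j]_l,j}$ for $0\le i<l$, $0\le j<n$. Flattening: an $a\times b$ matrix is flattened to a vector of length $ab$; in column-major order its $(i,j)$ entry is placed at position $i+j\cdot a$, and in row-major order at position $i\cdot b+j$. $\mathbf{U}^\tau$ is the $0/1$ matrix that sends the flattening of $\mathcal{B}$ to the flattening of $\tau(\mathcal{B})$ (same flattening order for both) for every $\mathcal{B}$. That is, the row of $\mathbf{U}^\tau$ indexed by the position of $(i,j)$ has its single entry $1$ in the column indexed by the position of $([i+j]_l,j)$. In column-major order this reads $\mathbf{U}^\tau_{i+jl,\,h}=1$ if $h=[i+j]_l+j\cdot l$ and $0$ otherwise. Diagonals: for a $y\times x$ matrix $U$ and an integer $z$ with $-y\le z<x$, the $z$-th diagonal consists of the entries $U_{r,c}$ with $c-r=z$ (no cyclic wrap-around); it is non-zero if at least one of these entries is non-zero. *)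

theory Defs
  imports "Jordan_Normal_Form.Matrix"
begin

definition tau :: "'a mat \<Rightarrow> 'a mat" where
  "tau B = mat (dim_row B) (dim_col B) (\<lambda>(i, j). B $$ ((i + j) mod dim_row B, j))"

datatype flat_order = Column_Major | Row_Major

text \<open>Position of the entry \<open>(i, j)\<close> of an \<open>a \<times> b\<close> matrix in its flattening.\<close>

fun pos :: "flat_order \<Rightarrow> nat \<Rightarrow> nat \<Rightarrow> nat \<times> nat \<Rightarrow> nat" where
  "pos Column_Major a b (i, j) = i + j * a"
| "pos Row_Major a b (i, j) = i * b + j"

fun flatten :: "flat_order \<Rightarrow> 'a mat \<Rightarrow> 'a vec" where
  "flatten Column_Major B =
     vec (dim_row B * dim_col B) (\<lambda>p. B $$ (p mod dim_row B, p div dim_row B))"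
| "flatten Row_Major B =
     vec (dim_row B * dim_col B) (\<lambda>p. B $$ (p div dim_col B, p mod dim_col B))"

text \<open>The lemmas \<open>U_tau_mult_flatten\<close> and \<open>U_tau_unique\<close> below show that this is the matrix of
  \<^const>\<open>tau\<close> acting on flattened \<open>l \<times> n\<close> matrices.\<close>

definition U_tau :: "flat_order \<Rightarrow> nat \<Rightarrow> nat \<Rightarrow> 'a :: {zero, one} mat" where
  "U_tau ord l n = mat (l * n) (l * n) (\<lambda>(r, h).
     if \<exists>i<l. \<exists>j<n. r = pos ord l n (i, j) \<and> h = pos ord l n ((i + j) mod l, j)
     then 1 else 0)"

definition diagonal :: "'a mat \<Rightarrow> int \<Rightarrow> 'a set" where
  "diagonal U z = {U $$ (r, c) | r c. r < dim_row U \<and> c < dim_col U \<and> int c - int r = z}"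

definition nonzero_diagonals :: "'a :: zero mat \<Rightarrow> int set" where
  "nonzero_diagonals U =
     {z. - int (dim_row U) \<le> z \<and> z < int (dim_col U) \<and> (\<exists>u \<in> diagonal U z. u \<noteq> 0)}"

lemma finite_nonzero_diagonals: "finite (nonzero_diagonals U)"
  by (rule finite_subset[of _ "{- int (dim_row U)..<int (dim_col U)}"])
     (auto simp: nonzero_diagonals_def)

lemma pos_less:
  assumes "i < l" "j < n"
  shows "pos ord l n (i, j) < l * n"
proof (cases ord)
  case Column_Major
  have "i + j * l < Suc j * l" using assms by simp
  also have "\<dots> \<le> n * l" using assms by (intro mult_right_mono) auto
  finally show ?thesis using Column_Major by (simp add: mult.commute)
next
  case Row_Major
  have "i * n + j < Suc i * n" using assms by simp
  also have "\<dots> \<le> l * n" using assms by (intro mult_right_mono) auto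
  finally show ?thesis using Row_Major by simp
qed

lemma pos_inj:
  assumes "i < l" "j < n" "i' < l" "j' < n"
    and "pos ord l n (i, j) = pos ord l n (i', j')"
  shows "i = i'" "j = j'"
proof -
  have "i = i' \<and> j = j'"
  proof (cases ord)
    case Column_Major
    then have e: "i + j * l = i' + j' * l" using assms by simp
    from arg_cong[OF e, of "\<lambda>x. x mod l"] arg_cong[OF e, of "\<lambda>x. x div l"]
    show ?thesis using assms by simp
  next
    case Row_Major
    then have e: "j + i * n = j' + i' * n" using assms by simp
    from arg_cong[OF e, of "\<lambda>x. x mod n"] arg_cong[OF e, of "\<lambda>x. x div n"]
    show ?thesis using assms by simp
  qed
  then show "i = i'" "j = j'" by auto
qed

lemma pos_surj:
  assumes "p < l * n"
  obtains i j where "i < l" "j < n" "p = pos ord l n (i, j)"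
proof (cases ord)
  case Column_Major
  have "0 < l" using assms by (cases l) auto
  moreover have "p div l < n"
    using assms by (simp add: less_mult_imp_div_less mult.commute)
  ultimately show ?thesis using Column_Major by (intro that[of "p mod l" "p div l"]) auto
next
  case Row_Major
  have "0 < n" using assms by (cases n) auto
  moreover have "p div n < l" using assms by (simp add: less_mult_imp_div_less)
  ultimately show ?thesis using Row_Major by (intro that[of "p div n" "p mod n"]) auto
qed

lemma dim_flatten: "dim_vec (flatten ord B) = dim_row B * dim_col B"
  by (cases ord) auto

lemma flatten_pos:
  assumes "B \<in> carrier_mat l n" "i < l" "j < n"
  shows "flatten ord B $ pos ord l n (i, j) = B $$ (i, j)"
  using assms pos_less[OF assms(2,3), of ord] by (cases ord) auto

lemma U_tau_mult_flatten:
  fixes B :: "'a :: comm_ring_1 mat"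
  assumes B: "B \<in> carrier_mat l n"
  shows "U_tau ord l n *\<^sub>v flatten ord B = flatten ord (tau B)"
proof (rule eq_vecI)
  have dims: "dim_row B = l" "dim_col B = n" using B by auto
  have tB: "tau B \<in> carrier_mat l n" using dims by (simp add: tau_def)
  then have dt: "dim_vec (flatten ord (tau B)) = l * n" by (auto simp: dim_flatten)
  show "dim_vec (U_tau ord l n *\<^sub>v flatten ord B) = dim_vec (flatten ord (tau B))"
    by (simp add: dt U_tau_def)
  fix p assume "p < dim_vec (flatten ord (tau B))"
  then have p: "p < l * n" by (simp add: dt)
  then obtain i j where ij: "i < l" "j < n" and pij: "p = pos ord l n (i, j)"
    by (rule pos_surj)
  define q where "q = pos ord l n ((i + j) mod l, j)"
  have m: "(i + j) mod l < l" using ij by simp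
  have q: "q < l * n" unfolding q_def by (rule pos_less[OF m ij(2)])
  have U: "U_tau ord l n $$ (p, h) = (if h = q then 1 else (0 :: 'a))" if "h < l * n" for h
  proof -
    have "(\<exists>i'<l. \<exists>j'<n. p = pos ord l n (i', j') \<and> h = pos ord l n ((i' + j') mod l, j'))
      \<longleftrightarrow> h = q"
    proof
      assume "\<exists>i'<l. \<exists>j'<n. p = pos ord l n (i', j') \<and> h = pos ord l n ((i' + j') mod l, j')"
      then obtain i' j' where 1: "i' < l" "j' < n" "p = pos ord l n (i', j')"
        "h = pos ord l n ((i' + j') mod l, j')" by blast
      have "i = i'" "j = j'" using pos_inj[OF ij 1(1,2), of ord] 1(3) pij by simp_all
      then show "h = q" using 1 by (simp add: q_def)
    next
      assume "h = q"
      then show "\<exists>i'<l. \<exists>j'<n. p = pos ord l n (i', j') \<and> h = pos ord l n ((i' + j') mod l, j')"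
        using ij pij q_def by blast
    qed
    then show ?thesis using p that by (simp add: U_tau_def)
  qed
  have "(U_tau ord l n *\<^sub>v flatten ord B) $ p
      = (\<Sum>h\<in>{0..<l * n}. U_tau ord l n $$ (p, h) * flatten ord B $ h)"
    using p by (simp add: mult_mat_vec_def scalar_prod_def dim_flatten dims U_tau_def)
  also have "\<dots> = (\<Sum>h\<in>{0..<l * n}. if h = q then flatten ord B $ h else 0)"
    by (rule sum.cong) (auto simp: U)
  also have "\<dots> = flatten ord B $ q" using q by simp
  also have "\<dots> = B $$ ((i + j) mod l, j)"
    unfolding q_def by (rule flatten_pos[OF B m ij(2)])
  also have "\<dots> = tau B $$ (i, j)" using ij dims by (simp add: tau_def)
  also have "\<dots> = flatten ord (tau B) $ p"
    unfolding pij by (rule flatten_pos[OF tB ij, symmetric])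
  finally show "(U_tau ord l n *\<^sub>v flatten ord B) $ p = flatten ord (tau B) $ p" .
qed

lemma U_tau_unique:
  fixes M :: "'a :: comm_ring_1 mat"
  assumes M: "M \<in> carrier_mat (l * n) (l * n)"
    and act: "\<And>B. B \<in> carrier_mat l n \<Longrightarrow> M *\<^sub>v flatten ord B = flatten ord (tau B)"
  shows "M = U_tau ord l n"
proof (rule eq_matI)
  let ?U = "U_tau ord l n :: 'a mat"
  have U: "?U \<in> carrier_mat (l * n) (l * n)" by (simp add: U_tau_def)
  show "dim_row M = dim_row ?U" "dim_col M = dim_col ?U" using M U by auto
  fix r c assume "r < dim_row ?U" "c < dim_col ?U"
  then have rc: "r < l * n" "c < l * n" using U by auto
  define B :: "'a mat" where
    "B = mat l n (\<lambda>ij. if pos ord l n ij = c then 1 else 0)"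
  have B: "B \<in> carrier_mat l n" by (simp add: B_def)
  have "flatten ord B = unit_vec (l * n) c"
  proof (rule eq_vecI)
    show "dim_vec (flatten ord B) = dim_vec (unit_vec (l * n) c)"
      by (simp add: dim_flatten B_def)
    fix p assume "p < dim_vec (unit_vec (l * n) c :: 'a vec)"
    then have p: "p < l * n" by simp
    then obtain i j where ij: "i < l" "j < n" "p = pos ord l n (i, j)" by (rule pos_surj)
    have "flatten ord B $ p = B $$ (i, j)" unfolding ij(3) by (rule flatten_pos[OF B ij(1,2)])
    also have "\<dots> = unit_vec (l * n) c $ p" using ij p by (simp add: B_def unit_vec_def)
    finally show "flatten ord B $ p = unit_vec (l * n) c $ p" .
  qed
  then have "M *\<^sub>v unit_vec (l * n) c = ?U *\<^sub>v unit_vec (l * n) c"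
    using act[OF B] U_tau_mult_flatten[OF B, of ord] by simp
  then have "(M *\<^sub>v unit_vec (l * n) c) $ r = (?U *\<^sub>v unit_vec (l * n) c) $ r" by simp
  then show "M $$ (r, c) = ?U $$ (r, c)"
    using M U rc by (simp add: scalar_prod_right_unit)
qed

end

(* The entry 1 in the row of position (i, j) lies on the diagonal s * ((i + j) mod l - i), where the
   stride s is 1 (column-major) or n (row-major). These shifts have absolute value below l, so there
   are at most 2 * l - 1 of them. If n \<le> l, each shift is j or j - l with j < n, and j - l does not
   occur for j = 0, so there are at most 2 * n - 1. *)

theory Submission
  imports Defs
begin

text \<open>The shifts are kept free of the stride, so that a single count serves both flattening
  orders.\<close>

definition row_shifts :: "nat \<Rightarrow> nat \<Rightarrow> int set" where
  "row_shifts l n = {int ((i + j) mod l) - int i | i j. i < l \<and> j < n}"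

lemma row_shifts_subset_symmetric: "row_shifts l n \<subseteq> {1 - int l..int l - 1}"
proof
  fix z assume "z \<in> row_shifts l n"
  then obtain i j where z: "z = int ((i + j) mod l) - int i" and i: "i < l"
    by (auto simp: row_shifts_def)
  moreover have "(i + j) mod l < l" using i by simp
  ultimately have "1 - int l \<le> z \<and> z \<le> int l - 1" by linarith
  then show "z \<in> {1 - int l..int l - 1}" by simp
qed

lemma row_shifts_subset_if_le:
  assumes "n \<le> l"
  shows "row_shifts l n \<subseteq> {0..<int n} \<union> {1 - int l..<int n - int l}"
proof
  fix z assume "z \<in> row_shifts l n"
  then obtain i j where z: "z = int ((i + j) mod l) - int i" and ij: "i < l" "j < n"
    by (auto simp: row_shifts_def)
  show "z \<in> {0..<int n} \<union> {1 - int l..<int n - int l}"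
  proof (cases "i + j < l")
    case True
    then show ?thesis using z ij by simp
  next
    case False
    \<comment> \<open>Since \<open>i < l\<close> and \<open>j < n \<le> l\<close>, the sum is below
      \<open>2 * l\<close> and wraps around exactly once.\<close>
    then have "(i + j) mod l = i + j - l"
      using ij assms by (simp add: le_mod_geq)
    \<comment> \<open>Now \<open>z = j - l\<close>, and \<open>i < l \<le> i + j\<close> forces
      \<open>1 \<le> j\<close>; hence the left end \<open>1 - l\<close>.\<close>
    then show ?thesis using z ij False by auto
  qed
qed

lemma finite_row_shifts: "finite (row_shifts l n)"
  by (rule finite_subset[OF row_shifts_subset_symmetric]) simp

lemma card_row_shifts:
  assumes "0 < n"
  shows "card (row_shifts l n) \<le> 2 * min n l - 1"
proof (cases "n \<le> l")
  case True
  have "card (row_shifts l n) \<le> card ({0..<int n} \<union> {1 - int l..<int n - int l})"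
    by (rule card_mono[OF _ row_shifts_subset_if_le[OF True]]) simp
  also have "\<dots> \<le> card {0..<int n} + card {1 - int l..<int n - int l}"
    by (rule card_Un_le)
  \<comment> \<open>The intervals have \<open>n\<close> and \<open>n - 1\<close> elements.\<close>
  also have "\<dots> = 2 * min n l - 1" using assms True by simp
  finally show ?thesis .
next
  case False
  have "card (row_shifts l n) \<le> card {1 - int l..int l - 1}"
    by (rule card_mono[OF _ row_shifts_subset_symmetric]) simp
  also have "\<dots> = 2 * min n l - 1" using False by simp
  finally show ?thesis .
qed

definition stride :: "flat_order \<Rightarrow> nat \<Rightarrow> int" where
  "stride ord n = (case ord of Column_Major \<Rightarrow> 1 | Row_Major \<Rightarrow> int n)"

text \<open>For a fixed column, the position is affine in the row index with slope
  \<open>stride ord n\<close>. As \<open>tau\<close> moves entries only within their column, this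
  determines the diagonal.\<close>

lemma pos_diff_same_column:
  "int (pos ord l n (i', j)) - int (pos ord l n (i, j)) = stride ord n * (int i' - int i)"
  by (cases ord) (simp_all add: stride_def algebra_simps)

lemma nonzero_diagonals_U_tau_subset:
  "nonzero_diagonals (U_tau ord l n :: 'a :: zero_neq_one mat) \<subseteq> (*) (stride ord n) ` row_shifts l n"
proof
  let ?U = "U_tau ord l n :: 'a mat"
  fix z assume "z \<in> nonzero_diagonals ?U"
  then obtain r c where rc: "r < l * n" "c < l * n" and z: "z = int c - int r"
    and nz: "?U $$ (r, c) \<noteq> 0"
    by (auto simp: nonzero_diagonals_def diagonal_def U_tau_def)
  \<comment> \<open>A non-zero entry comes from the \<open>then\<close> branch of
    \<open>U_tau\<close>, which supplies the matrix position \<open>(i, j)\<close>.\<close>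
  then obtain i j where ij: "i < l" "j < n"
    and r: "r = pos ord l n (i, j)" and c: "c = pos ord l n ((i + j) mod l, j)"
    by (auto simp: U_tau_def split: if_splits)
  have "z = stride ord n * (int ((i + j) mod l) - int i)"
    unfolding z r c by (rule pos_diff_same_column)
  then show "z \<in> (*) (stride ord n) ` row_shifts l n"
    using ij by (auto simp: row_shifts_def)
qed

lemma card_nonzero_diagonals_U_tau:
  assumes "0 < n"
  shows "card (nonzero_diagonals (U_tau ord l n :: 'a :: zero_neq_one mat)) \<le> 2 * min n l - 1"
  \<comment> \<open>Scaling by the stride cannot increase the number of shifts.\<close>
  using surj_card_le[OF finite_row_shifts nonzero_diagonals_U_tau_subset] card_row_shifts[OF assms]
  by (rule order_trans)

theorem mainTheorem3:
  fixes l n :: nat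
  assumes "0 < l" and "0 < n"
  shows "card (nonzero_diagonals (U_tau Column_Major l n :: 'a :: comm_ring_1 mat))
           \<le> 2 * min n l - 1 \<and>
         card (nonzero_diagonals (U_tau Row_Major l n :: 'a mat)) \<le> 2 * min n l - 1"
  using card_nonzero_diagonals_U_tau[OF assms(2)] by blast

end
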